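(* Let $m\geq 12$ be a constant integer and let $\mathcal{G}_{BA}(n,m)$ be the Barabási–Albert random graph on vertices $v_1,\dots,v_n$. Then there is a constant $\beta>0$ such that $$\lim_{n\to\infty}\Pr\big[\mathrm{tw}(\mathcal{G}_{BA}(n,m))>\beta n\big]=1.$$
   Context: The Barabási–Albert random graph $\mathcal{G}_{BA}(n,m)$ is generated by adding vertices $v_1,v_2,\dots,v_n$ one at a time (after some initial phase whose details do not matter). Let $G_{i-1}$ be the graph after $v_{i-1}$ is added, with total degree $(i-1)m$. When $v_i$ is added, its $m$ neighbours are chosen in $m$ steps; in step $j\in\{1,\dots,m\}$ an existing vertex $w$ is chosen with probability $\frac{\deg_{G_{i-1}}(w)+d_w(j)}{m(i-1)+2(j-1)}$, where $d_w(j)$ is the number of times $w$ was chosen as a neighbour of $v_i$ in the first $j-1$ steps (preferential attachment; multiple edges allowed). $\mathrm{tw}(G)$ denotes treewidth (the minimum $k$ such that $G$ is a subgraph of a $k$-tree).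
   Formalization: The printed attachment probabilities do not sum to 1; the denominator is replaced by the total degree of G_{i-1} plus (j-1). The initial phase is any fixed loopless multigraph with at least one edge, with β independent of it. *)

theory Defs
  imports "HOL-Probability.Probability"
begin

section \<open>Treewidth\<close>

inductive k_tree :: "nat \<Rightarrow> nat set \<Rightarrow> nat set set \<Rightarrow> bool" for k :: nat where
  complete: "finite V \<Longrightarrow> card V = k + 1 \<Longrightarrow> k_tree k V {e. e \<subseteq> V \<and> card e = 2}"
| extend: "k_tree k V E \<Longrightarrow> v \<notin> V \<Longrightarrow> C \<subseteq> V \<Longrightarrow> card C = k \<Longrightarrow>
    (\<forall>x\<in>C. \<forall>y\<in>C. x \<noteq> y \<longrightarrow> {x, y} \<in> E) \<Longrightarrow>
    k_tree k (insert v V) (E \<union> (\<lambda>c. {v, c}) ` C)"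

definition treewidth :: "nat set \<Rightarrow> nat set set \<Rightarrow> nat" where
  "treewidth V E = (LEAST k. \<exists>V' E'. k_tree k V' E' \<and> V \<subseteq> V' \<and> E \<subseteq> E')"

lemma treewidth_well_defined:
  assumes "finite V" and "\<And>e. e \<in> E \<Longrightarrow> e \<subseteq> V \<and> card e = 2"
  shows "\<exists>k V' E'. k_tree k V' E' \<and> V \<subseteq> V' \<and> E \<subseteq> E'"
proof -
  obtain x where x: "x \<notin> V"
    using assms(1) ex_new_if_finite infinite_UNIV_nat by blast
  have "k_tree (card V) (insert x V) {e. e \<subseteq> insert x V \<and> card e = 2}"
    by (rule k_tree.complete) (use assms(1) x in auto)
  moreover have "E \<subseteq> {e. e \<subseteq> insert x V \<and> card e = 2}"
    using assms(2) by blast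
  ultimately show ?thesis by blast
qed

section \<open>The Barab\'asi--Albert process\<close>

text \<open>
  The vertex \<open>v\<^sub>i\<close> is the number \<open>i\<close>; a loopless multigraph on \<open>v\<^sub>1, \<dots>, v\<^sub>n\<close> is given by its
  multiset of edges, each edge being a two-element subset of \<open>{1..n}\<close>.
\<close>

definition multigraph_on :: "nat \<Rightarrow> nat set multiset \<Rightarrow> bool" where
  "multigraph_on n E \<longleftrightarrow> (\<forall>e\<in>#E. e \<subseteq> {1..n} \<and> card e = 2)"

definition mdegree :: "nat set multiset \<Rightarrow> nat \<Rightarrow> nat" where
  "mdegree E w = size (filter_mset (\<lambda>e. w \<in> e) E)"

definition total_degree :: "nat \<Rightarrow> nat set multiset \<Rightarrow> nat" where
  "total_degree n E = (\<Sum>w\<in>{1..n}. mdegree E w)"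

text \<open>
  One step of the attachment of \<open>v\<^sub>i\<close> to \<open>G\<^sub>i\<^sub>-\<^sub>1\<close>, whose edges are \<open>E\<close>. The multiset \<open>N\<close> records the
  neighbours chosen so far, so that in step \<open>j\<close> we have \<open>count N w = d\<^sub>w(j)\<close> and \<open>size N = j - 1\<close>.
  The denominator is the sum of the numerators over the existing vertices, which is what makes this
  a probability distribution; see \<open>pmf_attach_step\<close> and \<open>total_degree_eq\<close>.
  The expression \<open>m * (i - 1) + 2 * (j - 1)\<close> sometimes written for it is not that sum: \<open>m * (i - 1)\<close>
  counts the edges of \<open>G\<^sub>i\<^sub>-\<^sub>1\<close>, each contributing two to the total degree, while the first \<open>j - 1\<close>
  choices contribute one each.
\<close>

definition attach_step :: "nat \<Rightarrow> nat set multiset \<Rightarrow> nat multiset \<Rightarrow> nat pmf" where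
  "attach_step i E N = embed_pmf (\<lambda>w. if w \<in> {1..i - 1}
     then real (mdegree E w + count N w) / real (total_degree (i - 1) E + size N) else 0)"

primrec choose_neighbours :: "nat \<Rightarrow> nat set multiset \<Rightarrow> nat \<Rightarrow> nat multiset pmf" where
  "choose_neighbours i E 0 = return_pmf {#}"
| "choose_neighbours i E (Suc j) =
     bind_pmf (choose_neighbours i E j) (\<lambda>N. map_pmf (\<lambda>w. add_mset w N) (attach_step i E N))"

text \<open>
  The initial phase is an arbitrary multigraph \<open>E0\<close> on \<open>v\<^sub>1, \<dots>, v\<^sub>n\<^sub>0\<close> with at least one edge (without
  an edge the attachment probabilities are undefined). The value for \<open>n < n0\<close> is a dummy.
\<close>

definition initial_graph :: "nat \<Rightarrow> nat set multiset \<Rightarrow> bool" where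
  "initial_graph n0 E0 \<longleftrightarrow> multigraph_on n0 E0 \<and> E0 \<noteq> {#}"

primrec BA_graph :: "nat \<Rightarrow> nat \<Rightarrow> nat set multiset \<Rightarrow> nat \<Rightarrow> nat set multiset pmf" where
  "BA_graph m n0 E0 0 = return_pmf E0"
| "BA_graph m n0 E0 (Suc n) =
     (if Suc n \<le> n0 then return_pmf E0
      else bind_pmf (BA_graph m n0 E0 n) (\<lambda>E.
        map_pmf (\<lambda>N. E + image_mset (\<lambda>w. {Suc n, w}) N) (choose_neighbours (Suc n) E m)))"

subsection \<open>Well-definedness of the process\<close>

lemma total_degree_eq:
  assumes "multigraph_on n E"
  shows "total_degree n E = 2 * size E"
  using assms
proof (induction E)
  case empty
  show ?case by (simp add: total_degree_def mdegree_def)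
next
  case (add e E)
  have e: "e \<subseteq> {1..n}" "card e = 2" and E: "multigraph_on n E"
    using add.prems by (auto simp: multigraph_on_def)
  have "total_degree n (add_mset e E) = (\<Sum>w\<in>{1..n}. mdegree E w + (if w \<in> e then 1 else 0))"
    unfolding total_degree_def by (intro sum.cong) (auto simp: mdegree_def)
  also have "\<dots> = total_degree n E + card ({1..n} \<inter> e)"
    by (simp add: sum.distrib total_degree_def sum.If_cases Int_def)
  also have "{1..n} \<inter> e = e" using e by blast
  finally show ?case using e E add.IH by simp
qed

lemma pmf_attach_step:
  assumes E: "multigraph_on (i - 1) E" "E \<noteq> {#}" and N: "set_mset N \<subseteq> {1..i - 1}"
  shows "pmf (attach_step i E N) w = (if w \<in> {1..i - 1}
    then real (mdegree E w + count N w) / real (total_degree (i - 1) E + size N) else 0)"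
proof -
  let ?D = "real (total_degree (i - 1) E + size N)"
  let ?f = "\<lambda>w. if w \<in> {1..i - 1} then real (mdegree E w + count N w) / ?D else 0"
  have "size E > 0" using E(2) by (simp add: nonempty_has_size)
  then have pos: "?D > 0" using total_degree_eq[OF E(1)] by simp
  have "size N = (\<Sum>w\<in>{1..i - 1}. count N w)"
    unfolding size_multiset_overloaded_eq using N
    by (intro sum.mono_neutral_left) (auto simp: not_in_iff)
  then have "(\<Sum>w\<in>{1..i - 1}. real (mdegree E w + count N w)) = ?D"
    by (simp add: total_degree_def sum.distrib)
  then have one: "(\<Sum>w\<in>{1..i - 1}. ?f w) = 1"
    using pos by (simp flip: sum_divide_distrib)
  have "(\<integral>\<^sup>+w. ennreal (?f w) \<partial>count_space UNIV) = (\<Sum>w\<in>{1..i - 1}. ennreal (?f w))"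
    by (rule nn_integral_count_space') auto
  also have "\<dots> = ennreal (\<Sum>w\<in>{1..i - 1}. ?f w)"
    by (rule sum_ennreal) auto
  finally have "(\<integral>\<^sup>+w. ennreal (?f w) \<partial>count_space UNIV) = 1"
    using one by simp
  then show ?thesis
    unfolding attach_step_def by (subst pmf_embed_pmf) auto
qed

lemma set_attach_step:
  assumes "multigraph_on (i - 1) E" "E \<noteq> {#}" "set_mset N \<subseteq> {1..i - 1}"
  shows "set_pmf (attach_step i E N) \<subseteq> {1..i - 1}"
  using pmf_attach_step[OF assms] by (auto simp: set_pmf_iff split: if_splits)

lemma set_choose_neighbours:
  assumes "multigraph_on (i - 1) E" "E \<noteq> {#}" "N \<in> set_pmf (choose_neighbours i E j)"
  shows "size N = j \<and> set_mset N \<subseteq> {1..i - 1}"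
  using assms(3)
proof (induction j arbitrary: N)
  case 0
  then show ?case by simp
next
  case (Suc j)
  then obtain N' w where N': "N' \<in> set_pmf (choose_neighbours i E j)"
    and w: "w \<in> set_pmf (attach_step i E N')" and N: "N = add_mset w N'"
    by auto
  show ?case
    using Suc.IH[OF N'] set_attach_step[OF assms(1,2), of N'] w N by auto
qed

text \<open>
  For \<open>size E0 = m * n0\<close> this gives \<open>m * (i - 1)\<close> edges in \<open>G\<^sub>i\<^sub>-\<^sub>1\<close>, and the denominator in step \<open>j\<close>
  of the attachment of \<open>v\<^sub>i\<close> becomes \<open>2 * m * (i - 1) + (j - 1)\<close>.
\<close>

lemma set_BA_graph:
  assumes "initial_graph n0 E0" "n \<ge> n0" "E \<in> set_pmf (BA_graph m n0 E0 n)"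
  shows "multigraph_on n E \<and> E \<noteq> {#} \<and> size E = size E0 + m * (n - n0)"
  using assms(2,3)
proof (induction n arbitrary: E)
  case 0
  then show ?case using assms(1) by (simp add: initial_graph_def)
next
  case (Suc n)
  show ?case
  proof (cases "Suc n \<le> n0")
    case True
    then have "n0 = Suc n" using Suc.prems by simp
    then show ?thesis using Suc.prems assms(1) by (simp add: initial_graph_def)
  next
    case False
    then obtain E' N where E': "E' \<in> set_pmf (BA_graph m n0 E0 n)"
      and N: "N \<in> set_pmf (choose_neighbours (Suc n) E' m)"
      and E: "E = E' + image_mset (\<lambda>w. {Suc n, w}) N"
      using Suc.prems by auto
    have IH: "multigraph_on n E'" "E' \<noteq> {#}" "size E' = size E0 + m * (n - n0)"
      using Suc.IH[OF _ E'] False by auto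
    have N2: "size N = m" "set_mset N \<subseteq> {1..n}"
      using set_choose_neighbours[of "Suc n" E' N m] IH N by auto
    have "card {Suc n, w} = 2" if "w \<in># N" for w
      using N2 that by (subst card_2_iff) force
    then have "multigraph_on (Suc n) E"
      using IH(1) N2 unfolding E multigraph_on_def by fastforce
    moreover have "size E = size E0 + m * (Suc n - n0)"
      using E IH(3) N2 False by (simp add: Suc_diff_le)
    ultimately show ?thesis using E IH(2) by simp
  qed
qed

end

theory Submission
  imports Defs
begin

text \<open>
  If the treewidth is at most \<open>n / 100\<close>, then a balanced separator of a containing \<open>k\<close>-tree yields
  disjoint vertex sets \<open>A\<close>, \<open>B\<close> without edges between them and with \<open>|A| |B| \<ge> n\<^sup>2 / 5\<close>. For fixed
  \<open>A\<close>, \<open>B\<close> this is unlikely: a vertex of \<open>A\<close> has to avoid \<open>B\<close> in \<open>m\<close> choices, and each earlier vertex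
  of \<open>B\<close>, having degree at least \<open>m\<close>, is hit by a single choice with probability at least about
  \<open>m / (2 m n)\<close>; likewise with \<open>A\<close> and \<open>B\<close> exchanged. So every pair in \<open>A \<times> B\<close> contributes a factor
  \<open>exp (- m / (2 n))\<close>, and the total probability is at most about \<open>exp (- m n / 10) \<le> exp (- 6 n / 5)\<close>.
  This beats the \<open>3\<^sup>n\<close> choices of \<open>(A, B)\<close>, since \<open>ln 3 < 6 / 5\<close>.
\<close>

section \<open>Balanced separators of \<open>k\<close>-trees\<close>

definition no_edges_between :: "'a set set \<Rightarrow> 'a set \<Rightarrow> 'a set \<Rightarrow> bool" where
  "no_edges_between F X Y \<longleftrightarrow> (\<forall>x\<in>X. \<forall>y\<in>Y. {x, y} \<notin> F)"

lemma no_edges_between_commute: "no_edges_between F X Y \<Longrightarrow> no_edges_between F Y X"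
  unfolding no_edges_between_def by (metis insert_commute)

lemma no_edges_between_mono:
  "no_edges_between F X Y \<Longrightarrow> X' \<subseteq> X \<Longrightarrow> Y' \<subseteq> Y \<Longrightarrow> no_edges_between F X' Y'"
  unfolding no_edges_between_def by blast

lemma k_tree_wf:
  assumes "k_tree k V E"
  shows "finite V \<and> (\<forall>e\<in>E. e \<subseteq> V \<and> card e = 2)"
  using assms
proof induction
  case (extend V E v C)
  have "card {v, c} = 2" if "c \<in> C" for c
    using that extend.hyps by (subst card_2_iff) blast
  then show ?case using extend by auto
qed auto

text \<open>
  The vertices of the \<open>k\<close>-tree that have already been peeled off, in reverse order of insertion, are
  grouped into the light, mutually nonadjacent parts \<open>P\<close>, each attached to a clique of the
  remaining \<open>k\<close>-tree. Peeling off \<open>v\<close> merges \<open>v\<close> with all parts adjacent to it. The first time the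
  merged part is heavy, \<open>v\<close> and its clique form the separator.
\<close>
lemma k_tree_separator_step:
  assumes "k_tree k V E" and "finite W"
    and "V \<union> \<Union>P = U" "V \<inter> \<Union>P = {}" "finite P" "disjoint P"
    and "\<And>x y. x \<in> V \<Longrightarrow> y \<in> V \<Longrightarrow> {x, y} \<in> F \<Longrightarrow> {x, y} \<in> E"
    and "\<And>D. D \<in> P \<Longrightarrow> 2 * card (D \<inter> W) \<le> card W"
    and "\<And>D. D \<in> P \<Longrightarrow> \<exists>C\<subseteq>V. (\<forall>x\<in>C. \<forall>y\<in>C. x \<noteq> y \<longrightarrow> {x, y} \<in> E) \<and>
      no_edges_between F D (U - (D \<union> C))"
  shows "\<exists>K Q. card K \<le> k + 1 \<and> finite K \<and> finite Q \<and> disjoint Q \<and> \<Union>Q = U - K \<and>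
    (\<forall>D\<in>Q. 2 * card (D \<inter> W) \<le> card W \<and> no_edges_between F D (U - (D \<union> K)))"
  using assms(1,3-)
proof (induction arbitrary: P)
  case (complete V)
  \<comment> \<open>When only the initial clique remains, its \<open>k + 1\<close> vertices form the
    separator, and all parts are still light.\<close>
  have "no_edges_between F D (U - (D \<union> V))" if "D \<in> P" for D
    using complete.prems(7)[OF that] unfolding no_edges_between_def by blast
  moreover have "\<Union>P = U - V" using complete.prems(1,2) by blast
  ultimately show ?case
    using complete by (intro exI[of _ V] exI[of _ P]) auto
next
  case (extend V E v C)
  note pr = extend.prems
  have wf: "finite V" "\<And>e. e \<in> E \<Longrightarrow> e \<subseteq> V \<and> card e = 2"
    using k_tree_wf[OF extend.hyps(1)] by auto
  have finC: "finite C" using extend.hyps(3) wf(1) finite_subset by blast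
  \<comment> \<open>\<open>v\<close> merges the parts in \<open>P1\<close> into \<open>N\<close>;
    those in \<open>P2\<close> stay as they are.\<close>
  define P1 where "P1 = {D\<in>P. \<not> no_edges_between F D {v}}"
  define N where "N = insert v (\<Union>P1)"
  define P2 where "P2 = P - P1"
  have P1P: "P1 \<subseteq> P" unfolding P1_def by blast
  have vP: "v \<notin> \<Union>P" using pr(2) by blast
  have nbr: "y \<in> C" if vy: "{v, y} \<in> E \<union> (\<lambda>c. {v, c}) ` C" "v \<noteq> y" for y
  proof -
    have "{v, y} \<notin> E" using wf(2)[of "{v,y}"] extend.hyps(2) by blast
    then obtain c where "c \<in> C" "{v, y} = {v, c}" using vy(1) by blast
    then show ?thesis using vy(2) by (auto simp: doubleton_eq_iff)
  qed
  have P1_sep: "no_edges_between F D (U - (D \<union> insert v C))" if "D \<in> P1" for D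
  proof -
    have D: "D \<in> P" "\<not> no_edges_between F D {v}" using that unfolding P1_def by auto
    obtain CD where CD: "CD \<subseteq> insert v V"
      "\<forall>x\<in>CD. \<forall>y\<in>CD. x \<noteq> y \<longrightarrow> {x, y} \<in> E \<union> (\<lambda>c. {v, c}) ` C"
      "no_edges_between F D (U - (D \<union> CD))"
      using pr(7)[OF D(1)] by (elim exE conjE) (rule that)
    have "v \<in> U" "v \<notin> D" using pr(1) vP D(1) by auto
    then have vCD: "v \<in> CD" using CD(3) D(2) unfolding no_edges_between_def by blast
    \<comment> \<open>A clique through \<open>v\<close> consists of \<open>v\<close> and neighbours
      of \<open>v\<close>, so the clique of a part adjacent to \<open>v\<close> lies in
      \<open>insert v C\<close>.\<close>
    have "y \<in> insert v C" if y: "y \<in> CD" for y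
    proof (cases "v = y")
      case False
      then show ?thesis by (intro insertI2 nbr CD(2)[rule_format, OF vCD y])
    next
      case True
      then show ?thesis by blast
    qed
    then have "CD \<subseteq> insert v C" by blast
    then show ?thesis using CD(3) by (elim no_edges_between_mono) auto
  qed
  \<comment> \<open>An \<open>F\<close>-neighbour of \<open>v\<close> that is still in the tree lies
    in \<open>C\<close>; one that was peeled off lies in a part adjacent to \<open>v\<close>, hence
    in \<open>N\<close>.\<close>
  have v_sep: "no_edges_between F {v} (U - (N \<union> C))"
    unfolding no_edges_between_def
  proof (intro ballI)
    fix x y assume x: "x \<in> {v}" and y: "y \<in> U - (N \<union> C)"
    show "{x, y} \<notin> F"
    proof
      assume "{x, y} \<in> F"
      then have F: "{v, y} \<in> F" "{y, v} \<in> F" using x by (auto simp: insert_commute)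
      have yv: "y \<noteq> v" using y unfolding N_def by blast
      show False
      proof (cases "y \<in> insert v V")
        case True
        then have "{v, y} \<in> E \<union> (\<lambda>c. {v, c}) ` C" using pr(5) F(1) by blast
        then show False using nbr yv y by blast
      next
        case False
        then obtain D where "D \<in> P" "y \<in> D" using y pr(1) by blast
        then have "D \<in> P1" using F(2) unfolding P1_def no_edges_between_def by blast
        then show False using y \<open>y \<in> D\<close> unfolding N_def by blast
      qed
    qed
  qed
  have N_sep: "no_edges_between F N (U - (N \<union> C))"
    unfolding no_edges_between_def
  proof (intro ballI)
    fix x y assume x: "x \<in> N" and y: "y \<in> U - (N \<union> C)"
    show "{x, y} \<notin> F"
    proof (cases "x = v")
      case True
      then show ?thesis using v_sep y unfolding no_edges_between_def by blast
    next
      case False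
      then obtain D where D: "D \<in> P1" "x \<in> D" using x unfolding N_def by blast
      have "y \<in> U - (D \<union> insert v C)" using y D unfolding N_def by blast
      then show ?thesis using P1_sep[OF D(1)] D(2) unfolding no_edges_between_def by blast
    qed
  qed
  have disj1: "disjoint P1" "disjoint P2"
    using pr(4) P1P unfolding P2_def by (auto intro: pairwise_subset)
  show ?case
  proof (cases "2 * card (N \<inter> W) \<le> card W")
    case True
    \<comment> \<open>A light \<open>N\<close> becomes a part of the smaller tree, attached to the
      clique \<open>C\<close>.\<close>
    let ?P = "insert N P2"
    have UP: "\<Union>P = \<Union>P1 \<union> \<Union>P2" using P1P unfolding P2_def by blast
    have P12: "\<Union>P1 \<inter> \<Union>P2 = {}"
    proof (rule ccontr)
      assume "\<Union>P1 \<inter> \<Union>P2 \<noteq> {}"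
      then obtain x D D' where "D \<in> P1" "D' \<in> P2" "x \<in> D" "x \<in> D'" by blast
      then show False using disjointD[OF pr(4), of D D'] P1P unfolding P2_def by blast
    qed
    have NP2: "N \<inter> \<Union>P2 = {}" using P12 vP UP unfolding N_def by blast
    show ?thesis
    proof (rule extend.IH[of ?P])
      show "V \<union> \<Union>?P = U" using pr(1) UP unfolding N_def by auto
      show "V \<inter> \<Union>?P = {}" using pr(2) UP extend.hyps(2) unfolding N_def by auto
      show "finite ?P" using pr(3) unfolding P2_def by simp
      have "N \<inter> D = {}" "D \<inter> N = {}" if "D \<in> P2" for D using NP2 that by auto
      then show "disjoint ?P" using disj1(2) by (simp add: pairwise_insert disjnt_def)
      fix x y assume xy: "x \<in> V" "y \<in> V" "{x, y} \<in> F"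
      then have "{x, y} \<in> E \<union> (\<lambda>c. {v, c}) ` C" using pr(5) by blast
      then show "{x, y} \<in> E" using xy(1,2) extend.hyps(2) by (auto simp: doubleton_eq_iff)
    next
      fix D assume "D \<in> ?P"
      then show "2 * card (D \<inter> W) \<le> card W" using True pr(6) unfolding P2_def by blast
    next
      fix D assume "D \<in> ?P"
      then consider "D = N" | "D \<in> P2" by blast
      then show "\<exists>C\<subseteq>V. (\<forall>x\<in>C. \<forall>y\<in>C. x \<noteq> y \<longrightarrow> {x, y} \<in> E) \<and>
        no_edges_between F D (U - (D \<union> C))"
      proof cases
        case 1
        then show ?thesis using N_sep extend.hyps(3,5) by blast
      next
        case 2
        then have D: "D \<in> P" "no_edges_between F D {v}" unfolding P1_def P2_def by auto
        obtain CD where CD: "CD \<subseteq> insert v V"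
          "\<forall>x\<in>CD. \<forall>y\<in>CD. x \<noteq> y \<longrightarrow> {x, y} \<in> E \<union> (\<lambda>c. {v, c}) ` C"
          "no_edges_between F D (U - (D \<union> CD))"
          using pr(7)[OF D(1)] by (elim exE conjE) (rule that)
        \<comment> \<open>As \<open>D\<close> is not adjacent to \<open>v\<close>, its clique can
          drop \<open>v\<close> and still separate it; what is left is a clique of the smaller
          tree.\<close>
        have "no_edges_between F D (U - (D \<union> (CD - {v})))"
          using CD(3) D(2) unfolding no_edges_between_def by blast
        moreover have "\<forall>x\<in>CD - {v}. \<forall>y\<in>CD - {v}. x \<noteq> y \<longrightarrow> {x, y} \<in> E"
        proof (intro ballI impI)
          fix x y assume xy: "x \<in> CD - {v}" "y \<in> CD - {v}" "x \<noteq> y"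
          have "{x, y} \<in> E \<union> (\<lambda>c. {v, c}) ` C" using xy by (intro CD(2)[rule_format]) auto
          moreover have "{x, y} \<notin> (\<lambda>c. {v, c}) ` C"
          proof
            assume "{x, y} \<in> (\<lambda>c. {v, c}) ` C"
            then have "v \<in> {x, y}" by (elim imageE) simp
            then show False using xy by simp
          qed
          ultimately show "{x, y} \<in> E" by simp
        qed
        moreover have "CD - {v} \<subseteq> V" using CD(1) by blast
        ultimately show ?thesis by (intro exI[of _ "CD - {v}"] conjI)
      qed
    qed
  next
    case False
    \<comment> \<open>A heavy \<open>N\<close> leaves less than half of \<open>W\<close> to
      \<open>?R\<close>, and without \<open>v\<close> it falls apart into the light parts in
      \<open>P1\<close>.\<close>
    let ?K = "insert v C" and ?R = "U - (N \<union> C)"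
    have CV: "C \<subseteq> V" by fact
    have N_W: "card (?R \<inter> W) + card (N \<inter> W) \<le> card W"
    proof -
      have "card (?R \<inter> W) + card (N \<inter> W) = card (?R \<inter> W \<union> N \<inter> W)"
        using assms(2) by (intro card_Un_disjoint[symmetric]) auto
      also have "\<dots> \<le> card W" using assms(2) by (intro card_mono) auto
      finally show ?thesis .
    qed
    have "\<Union>(insert ?R P1) = U - ?K"
    proof -
      have "\<Union>P1 \<subseteq> \<Union>P" using P1P by (rule Union_mono)
      then have "\<Union>P1 \<subseteq> U - ?K" using pr(1,2) CV by blast
      then show ?thesis unfolding N_def by auto
    qed
    moreover have "?R \<inter> D = {}" "D \<inter> ?R = {}" if "D \<in> P1" for D using that unfolding N_def by auto
    then have "disjoint (insert ?R P1)" using disj1(1) by (simp add: pairwise_insert disjnt_def)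
    moreover have "no_edges_between F ?R (U - (?R \<union> ?K))"
      using no_edges_between_commute[OF N_sep] by (elim no_edges_between_mono) auto
    moreover have "card ?K \<le> k + 1" using extend.hyps finC by (simp add: card_insert_if)
    moreover have "2 * card (D \<inter> W) \<le> card W" if "D \<in> P1" for D using pr(6) P1P that by blast
    moreover have "2 * card (?R \<inter> W) \<le> card W" using N_W False by linarith
    moreover have "finite P1" using pr(3) P1P finite_subset by blast
    ultimately show ?thesis using finC P1_sep
      by (intro exI[of _ ?K] exI[of _ "insert ?R P1"]) auto
  qed
qed

text \<open>Among the groups of parts that carry at least a third of \<open>W - K\<close>, a
  smallest one gives \<open>A\<close> and the other parts give \<open>B\<close>. If the group has at
  most one part, then \<open>A\<close> is light. Otherwise, by minimality, one of its parts and the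
  rest of the group each carry less than a third, so more than a third remains for
  \<open>B\<close>.\<close>

lemma k_tree_balanced_separation:
  assumes kt: "k_tree k V E" and W: "W \<subseteq> V"
  obtains K A B where "finite K" "card K \<le> k + 1" "A \<union> B = W - K" "A \<inter> B = {}"
    "no_edges_between E A B" "card (W - K) \<le> 3 * card A"
    "card (W - K) \<le> 3 * card B \<or> 2 * card A \<le> card W"
proof -
  have finW: "finite W" using k_tree_wf[OF kt] W finite_subset by blast
  obtain K P where K: "finite K" "card K \<le> k + 1" and P: "finite P" "disjoint P" "\<Union>P = V - K"
    and light: "\<And>D. D \<in> P \<Longrightarrow> 2 * card (D \<inter> W) \<le> card W"
    and sep: "\<And>D. D \<in> P \<Longrightarrow> no_edges_between E D (V - (D \<union> K))"
    using k_tree_separator_step[OF kt finW, of "{}" V E] by auto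
  define u where "u = card (W - K)"
  define w where "w Q = card (\<Union>Q \<inter> W)" for Q
  define S where "S = {Q. Q \<subseteq> P \<and> u \<le> 3 * w Q}"
  have PW: "\<Union>P \<inter> W = W - K" using P(3) W by blast
  have "P \<in> S" using PW by (simp add: S_def w_def u_def)
  then obtain Q where Q: "Q \<in> S" and min: "\<And>Q'. Q' \<in> S \<Longrightarrow> card Q \<le> card Q'"
    using ex_has_least_nat[of "\<lambda>Q. Q \<in> S" P card] by blast
  have QP: "Q \<subseteq> P" "u \<le> 3 * w Q" using Q unfolding S_def by auto
  have finQ: "finite Q" using QP(1) P(1) finite_subset by blast
  let ?A = "\<Union>Q \<inter> W" and ?B = "\<Union>(P - Q) \<inter> W"
  have AB: "?A \<union> ?B = W - K" using PW QP(1) by blast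
  have disj: "?A \<inter> ?B = {}"
  proof (rule ccontr)
    assume "?A \<inter> ?B \<noteq> {}"
    then obtain x D D' where "D \<in> Q" "D' \<in> P - Q" "x \<in> D" "x \<in> D'" by blast
    then show False using disjointD[OF P(2), of D D'] QP(1) by blast
  qed
  have "no_edges_between E ?A ?B"
    unfolding no_edges_between_def
  proof (intro ballI)
    fix x y assume x: "x \<in> ?A" and y: "y \<in> ?B"
    then obtain D where D: "D \<in> Q" "x \<in> D" by blast
    then have "y \<in> V - (D \<union> K)" using y disj x P(3) by blast
    then show "{x, y} \<notin> E" using sep[of D] D QP(1) unfolding no_edges_between_def by blast
  qed
  moreover have "u \<le> 3 * card ?B \<or> 2 * card ?A \<le> card W"
  proof (cases "\<exists>D. Q \<subseteq> {D}")
    case True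
    then have "Q = {} \<or> (\<exists>D\<in>P. Q = {D})" using QP(1) by blast
    then show ?thesis using light by auto
  next
    case False
    then obtain D where D: "D \<in> Q" by blast
    have c2: "card Q \<ge> 2"
    proof -
      have "card {D} < card Q" using False D finQ by (intro psubset_card_mono) auto
      then show ?thesis by simp
    qed
    have "{D} \<notin> S" using min[of "{D}"] c2 by auto
    then have 1: "3 * w {D} < u" using D QP(1) unfolding S_def by auto
    have "card (Q - {D}) < card Q" using D finQ by (intro psubset_card_mono) auto
    then have "Q - {D} \<notin> S" using min by (meson not_less)
    then have 2: "3 * w (Q - {D}) < u" using QP(1) unfolding S_def by auto
    have "card ?A \<le> w {D} + w (Q - {D})"
    proof -
      have "?A = (\<Union>{D} \<inter> W) \<union> (\<Union>(Q - {D}) \<inter> W)" using D by blast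
      then show ?thesis unfolding w_def by (metis card_Un_le)
    qed
    moreover have "u = card ?A + card ?B"
      unfolding u_def AB[symmetric] using finW disj by (intro card_Un_disjoint) auto
    ultimately show ?thesis using 1 2 by linarith
  qed
  ultimately show ?thesis
    using that[of K ?A ?B] K AB disj QP(2) unfolding u_def w_def by blast
qed

text \<open>A \<open>k\<close>-tree that attains the treewidth may have vertices outside
  \<open>{1..n}\<close>; this is why the separation is balanced with respect to a subset
  \<open>W\<close>, here \<open>{1..n}\<close>.\<close>

lemma small_treewidth_imp_separated_pair:
  assumes E: "multigraph_on n E"
    and tw: "real (treewidth {1..n} (set_mset E)) \<le> real n / 100" and n: "n \<ge> 100"
  obtains A B where "A \<subseteq> {1..n}" "B \<subseteq> {1..n}" "A \<inter> B = {}"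
    "no_edges_between (set_mset E) A B" "real n ^ 2 / 5 \<le> real (card A) * real (card B)"
proof -
  define k where "k = treewidth {1..n} (set_mset E)"
  have "\<exists>V' E'. k_tree k V' E' \<and> {1..n} \<subseteq> V' \<and> set_mset E \<subseteq> E'"
    unfolding k_def treewidth_def
    by (rule LeastI_ex) (use E in \<open>intro treewidth_well_defined; auto simp: multigraph_on_def\<close>)
  then obtain V' E' where k: "k_tree k V' E'" "{1..n} \<subseteq> V'" "set_mset E \<subseteq> E'" by blast
  obtain K A B where K: "finite K" "card K \<le> k + 1" and AB: "A \<union> B = {1..n} - K" "A \<inter> B = {}"
    and sep: "no_edges_between E' A B" and bal: "card ({1..n} - K) \<le> 3 * card A"
    "card ({1..n} - K) \<le> 3 * card B \<or> 2 * card A \<le> card {1..n}"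
    using k_tree_balanced_separation[OF k(1,2)] by metis
  have "finite A" "finite B" using AB(1) by (metis finite_Diff finite_Un finite_atLeastAtMost)+
  then have u: "card ({1..n} - K) = card A + card B"
    using AB card_Un_disjoint by metis
  have "card {1..n} - card K \<le> card ({1..n} - K)" by (rule diff_card_le_card_Diff[OF K(1)])
  then have "real n \<le> real (card A) + real (card B) + real k + 1" using K(2) u by simp
  \<comment> \<open>Both \<open>k\<close> and the summand 1 are at most
    \<open>n / 100\<close>.\<close>
  then have s: "98/100 * real n \<le> real (card A) + real (card B)"
    using tw n unfolding k_def by linarith
  have A: "3/10 * real n \<le> real (card A)" using bal(1) u s by linarith
  \<comment> \<open>\<open>B\<close> has at least a third of 98/100 of \<open>n\<close>, or else
    \<open>A\<close> has at most half of \<open>n\<close> and 48/100 remain for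
    \<open>B\<close>.\<close>
  have B: "3/10 * real n \<le> real (card B)" using bal(2) u s by auto
  \<comment> \<open>Expanding this product and bounding the sum of the two sizes by \<open>s\<close>
    yields the factor 3/10 * 98/100 - 9/100 = 204/1000, which exceeds 1/5.\<close>
  have "0 \<le> (real (card A) - 3/10 * real n) * (real (card B) - 3/10 * real n)"
    using A B by simp
  moreover have "98/100 * real n * (3/10 * real n) \<le> (real (card A) + real (card B)) * (3/10 * real n)"
    using s by (intro mult_right_mono) auto
  moreover have "0 \<le> real n * real n" by simp
  ultimately have "real n ^ 2 / 5 \<le> real (card A) * real (card B)"
    unfolding power2_eq_square by (simp only: algebra_simps)
  moreover have "no_edges_between (set_mset E) A B"
    using sep k(3) unfolding no_edges_between_def by blast
  ultimately show ?thesis using that[of A B] AB by blast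
qed

section \<open>Attachment probabilities\<close>

text \<open>Conditioning on the first stage: \<open>S\<close> can occur only after an outcome in
  \<open>T\<close>, and then with probability at most \<open>c\<close>. With \<open>T\<close> the
  same event one stage earlier, inductions multiply these factors.\<close>

lemma prob_bind_pmf_le:
  fixes c :: real
  assumes "\<And>x. x \<in> set_pmf p \<Longrightarrow> measure_pmf.prob (f x) S \<le> c * indicator T x"
  shows "measure_pmf.prob (bind_pmf p f) S \<le> c * measure_pmf.prob p T"
proof -
  have "measure_pmf.prob (bind_pmf p f) S = (\<integral>x. measure_pmf.prob (f x) S \<partial>measure_pmf p)"
    unfolding measure_pmf_bind
    by (rule measure_pmf.measure_bind[where N="count_space UNIV"])
       (auto simp: measure_pmf_in_subprob_algebra)
  also have "\<dots> \<le> (\<integral>x. c * indicator T x \<partial>measure_pmf p)"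
  proof (rule integral_mono_AE)
    show "integrable (measure_pmf p) (\<lambda>x. measure_pmf.prob (f x) S)"
      by (rule measure_pmf.integrable_const_bound[where B=1]) auto
    show "integrable (measure_pmf p) (\<lambda>x. c * indicator T x)"
      by (rule measure_pmf.integrable_const_bound[where B="\<bar>c\<bar>"]) (auto simp: indicator_def)
    show "AE x in measure_pmf p. measure_pmf.prob (f x) S \<le> c * indicator T x"
      using assms unfolding AE_measure_pmf_iff by blast
  qed
  also have "\<dots> = c * measure_pmf.prob p T" by simp
  finally show ?thesis .
qed

text \<open>Each vertex of \<open>X\<close> has a numerator of at least \<open>m\<close>, since
  earlier choices only increase it, over a denominator of at most \<open>d\<close>. A common
  \<open>d\<close> makes the estimate uniform over all steps.\<close>

lemma prob_attach_step_avoid: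
  fixes d :: real
  assumes E: "multigraph_on (i - 1) E" "E \<noteq> {#}" and N: "set_mset N \<subseteq> {1..i - 1}"
    and X: "X \<subseteq> {1..i - 1}" "\<And>w. w \<in> X \<Longrightarrow> m \<le> mdegree E w"
    and d: "real (2 * size E + size N) \<le> d"
  shows "measure_pmf.prob (attach_step i E N) (- X) \<le> 1 - real m * real (card X) / d"
proof -
  let ?D = "real (total_degree (i - 1) E + size N)"
  have D: "0 < ?D" "?D \<le> d"
    using E(2) d unfolding total_degree_eq[OF E(1)] by (auto simp: nonempty_has_size)
  have "real m * real (card X) / d = (\<Sum>w\<in>X. real m / d)" by simp
  also have "\<dots> \<le> (\<Sum>w\<in>X. pmf (attach_step i E N) w)"
  proof (rule sum_mono)
    fix w assume w: "w \<in> X"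
    have "real m / d \<le> real (mdegree E w + count N w) / ?D"
      using X(2)[OF w] D by (intro frac_le) auto
    then show "real m / d \<le> pmf (attach_step i E N) w"
      using w X(1) by (subst pmf_attach_step[OF E N]) auto
  qed
  also have "\<dots> = measure_pmf.prob (attach_step i E N) X"
    using X(1) finite_subset by (intro measure_measure_pmf_finite[symmetric]) blast
  finally show ?thesis
    using measure_pmf.prob_compl[of X "attach_step i E N"] by (simp add: Compl_eq_Diff_UNIV)
qed

lemma prob_choose_neighbours_avoid:
  fixes d :: real
  assumes E: "multigraph_on (i - 1) E" "E \<noteq> {#}"
    and X: "X \<subseteq> {1..i - 1}" "\<And>w. w \<in> X \<Longrightarrow> m \<le> mdegree E w"
    and d: "real (2 * size E + j) \<le> d"
  shows "measure_pmf.prob (choose_neighbours i E j) {N. set_mset N \<inter> X = {}}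
    \<le> (1 - real m * real (card X) / d) ^ j"
  using d
proof (induction j)
  case 0
  then show ?case by simp
next
  case (Suc j)
  let ?c = "1 - real m * real (card X) / d"
  \<comment> \<open>The factor is nonnegative because it bounds a probability, that of a first
    choice outside \<open>X\<close>.\<close>
  have "0 \<le> measure_pmf.prob (attach_step i E {#}) (- X)" by simp
  also have "\<dots> \<le> ?c" using Suc.prems by (intro prob_attach_step_avoid[OF E _ X]) auto
  finally have c: "0 \<le> ?c" .
  have "measure_pmf.prob (choose_neighbours i E (Suc j)) {N. set_mset N \<inter> X = {}}
    \<le> ?c * measure_pmf.prob (choose_neighbours i E j) {N. set_mset N \<inter> X = {}}"
    unfolding choose_neighbours.simps
  proof (rule prob_bind_pmf_le)
    fix N assume "N \<in> set_pmf (choose_neighbours i E j)"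
    then have N: "size N = j" "set_mset N \<subseteq> {1..i - 1}" using set_choose_neighbours[OF E] by auto
    have "(\<lambda>w. add_mset w N) -` {N. set_mset N \<inter> X = {}} =
      (if set_mset N \<inter> X = {} then - X else {})" by auto
    then show "measure_pmf.prob (map_pmf (\<lambda>w. add_mset w N) (attach_step i E N))
        {N. set_mset N \<inter> X = {}} \<le> ?c * indicator {N. set_mset N \<inter> X = {}} N"
      using prob_attach_step_avoid[OF E N(2) X, of d] Suc.prems N(1) by simp
  qed
  also have "\<dots> \<le> ?c * ?c ^ j" using c Suc by (intro mult_left_mono) auto
  finally show ?case by simp
qed

text \<open>A vertex added after the initial phase brings \<open>m\<close> edges with it, and edges
  are never removed.\<close>

lemma mdegree_BA_graph:
  assumes init: "initial_graph n0 E0" and "n \<ge> n0" "E \<in> set_pmf (BA_graph m n0 E0 n)"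
    and "n0 < w" "w \<le> n"
  shows "m \<le> mdegree E w"
  using assms(2,3,5)
proof (induction n arbitrary: E)
  case 0
  then show ?case using assms(4) by simp
next
  case (Suc n)
  have n: "\<not> Suc n \<le> n0" using Suc.prems assms(4) by simp
  then obtain E' N where E': "E' \<in> set_pmf (BA_graph m n0 E0 n)"
    and N: "N \<in> set_pmf (choose_neighbours (Suc n) E' m)"
    and E: "E = E' + image_mset (\<lambda>w. {Suc n, w}) N"
    using Suc.prems by auto
  have "multigraph_on n E'" "E' \<noteq> {#}" using set_BA_graph[OF init _ E'] n by auto
  then have N2: "size N = m" using set_choose_neighbours[of "Suc n" E' N m] N by auto
  show ?case
  proof (cases "w = Suc n")
    case True
    then show ?thesis using N2 unfolding E mdegree_def by (simp add: filter_mset_image_mset)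
  next
    case False
    then have "m \<le> mdegree E' w" using Suc.IH[OF _ E'] Suc.prems n by simp
    then show ?thesis unfolding E mdegree_def by simp
  qed
qed

text \<open>Induction on \<open>n\<close>: a new vertex on one side increases the product of the
  sizes by the size of the other side, which is the set that its \<open>m\<close> choices have to
  avoid. Initial vertices are not counted, as their degrees may be below \<open>m\<close>.\<close>

lemma prob_BA_graph_no_edges_between:
  fixes d :: real
  assumes init: "initial_graph n0 E0" and disj: "A \<inter> B = {}"
    and "n0 \<le> n" "real (2 * size E0 + 2 * m * n + m) \<le> d"
  shows "measure_pmf.prob (BA_graph m n0 E0 n) {E. no_edges_between (set_mset E) A B}
    \<le> exp (- (real m ^ 2 / d * (real (card (A \<inter> {n0<..n})) * real (card (B \<inter> {n0<..n})))))"
  using assms(3,4)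
proof (induction n rule: dec_induct)
  case base
  then show ?case by simp
next
  case (step n)
  define X where "X = A \<inter> {n0<..n}"
  define Y where "Y = B \<inter> {n0<..n}"
  have fin: "finite X" "finite Y" unfolding X_def Y_def by auto
  let ?s = "\<lambda>E. no_edges_between (set_mset E) A B"
  \<comment> \<open>The increment of the product of the sizes of \<open>X\<close> and
    \<open>Y\<close> due to \<open>Suc n\<close>.\<close>
  let ?g = "(if Suc n \<in> A then real (card Y) else 0) + (if Suc n \<in> B then real (card X) else 0)"
  have avoid: "measure_pmf.prob (choose_neighbours (Suc n) E m) {N. set_mset N \<inter> Z = {}}
      \<le> exp (- (real m ^ 2 / d * real (card Z)))"
    if E: "E \<in> set_pmf (BA_graph m n0 E0 n)" and Z: "Z \<subseteq> {n0<..n}" for E Z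
  proof -
    have wf: "multigraph_on (Suc n - 1) E" "E \<noteq> {#}" "size E = size E0 + m * (n - n0)"
      using set_BA_graph[OF init step.hyps(1) E] by auto
    have "2 * size E + m \<le> 2 * size E0 + 2 * m * Suc n + m"
      unfolding wf(3) by (simp add: diff_mult_distrib2)
    then have dE: "real (2 * size E + m) \<le> d" using step.prems by (meson of_nat_mono order_trans)
    let ?x = "real m * real (card Z) / d"
    have Z1: "Z \<subseteq> {1..Suc n - 1}" using Z by auto
    have deg: "m \<le> mdegree E w" if "w \<in> Z" for w
      using mdegree_BA_graph[OF init step.hyps(1) E, of w] that Z by auto
    have "0 \<le> measure_pmf.prob (attach_step (Suc n) E {#}) (- Z)" by simp
    also have "\<dots> \<le> 1 - ?x"
      using dE by (intro prob_attach_step_avoid[OF wf(1,2) _ Z1 deg]) auto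
    finally have x: "0 \<le> 1 - ?x" .
    have "measure_pmf.prob (choose_neighbours (Suc n) E m) {N. set_mset N \<inter> Z = {}} \<le> (1 - ?x) ^ m"
      by (rule prob_choose_neighbours_avoid[OF wf(1,2) Z1 deg dE])
    also have "\<dots> \<le> exp (- ?x) ^ m"
      using x exp_ge_add_one_self[of "- ?x"] by (intro power_mono) auto
    also have "\<dots> = exp (- (real m ^ 2 / d * real (card Z)))"
      by (simp add: power2_eq_square mult_ac flip: exp_of_nat_mult)
    finally show ?thesis .
  qed
  have "measure_pmf.prob (BA_graph m n0 E0 (Suc n)) {E. ?s E}
    = measure_pmf.prob (bind_pmf (BA_graph m n0 E0 n) (\<lambda>E.
        map_pmf (\<lambda>N. E + image_mset (\<lambda>w. {Suc n, w}) N) (choose_neighbours (Suc n) E m))) {E. ?s E}"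
    using step.hyps by simp
  also have "\<dots> \<le> exp (- (real m ^ 2 / d * ?g)) * measure_pmf.prob (BA_graph m n0 E0 n) {E. ?s E}"
  proof (rule prob_bind_pmf_le)
    fix E assume E: "E \<in> set_pmf (BA_graph m n0 E0 n)"
    let ?M = "(\<lambda>N. E + image_mset (\<lambda>w. {Suc n, w}) N) -` {E. ?s E}"
    have "measure_pmf.prob (choose_neighbours (Suc n) E m) ?M
      \<le> exp (- (real m ^ 2 / d * ?g)) * indicator {E. ?s E} E"
    proof (cases "?s E")
      case False
      \<comment> \<open>An edge between \<open>A\<close> and \<open>B\<close> that is already in
        \<open>E\<close> persists.\<close>
      then have "?M = {}" by (auto simp: no_edges_between_def)
      then show ?thesis by simp
    next
      case True
      consider "Suc n \<in> A" "Suc n \<notin> B" | "Suc n \<in> B" "Suc n \<notin> A" | "Suc n \<notin> A" "Suc n \<notin> B"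
        using disj by blast
      then have "measure_pmf.prob (choose_neighbours (Suc n) E m) ?M \<le> exp (- (real m ^ 2 / d * ?g))"
      proof cases
        case 1
        then have "?M \<subseteq> {N. set_mset N \<inter> Y = {}}"
          unfolding Y_def no_edges_between_def by auto
        then have "measure_pmf.prob (choose_neighbours (Suc n) E m) ?M
            \<le> measure_pmf.prob (choose_neighbours (Suc n) E m) {N. set_mset N \<inter> Y = {}}"
          by (intro measure_pmf.finite_measure_mono) auto
        also have "\<dots> \<le> exp (- (real m ^ 2 / d * real (card Y)))"
          by (rule avoid[OF E]) (simp add: Y_def)
        finally show ?thesis using 1 by simp
      next
        case 2
        then have "?M \<subseteq> {N. set_mset N \<inter> X = {}}"
          unfolding X_def no_edges_between_def by (auto simp: insert_commute)
        then have "measure_pmf.prob (choose_neighbours (Suc n) E m) ?M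
            \<le> measure_pmf.prob (choose_neighbours (Suc n) E m) {N. set_mset N \<inter> X = {}}"
          by (intro measure_pmf.finite_measure_mono) auto
        also have "\<dots> \<le> exp (- (real m ^ 2 / d * real (card X)))"
          by (rule avoid[OF E]) (simp add: X_def)
        finally show ?thesis using 2 by simp
      qed simp
      then show ?thesis using True by simp
    qed
    then show "measure_pmf.prob (map_pmf (\<lambda>N. E + image_mset (\<lambda>w. {Suc n, w}) N)
        (choose_neighbours (Suc n) E m)) {E. ?s E} \<le> exp (- (real m ^ 2 / d * ?g)) * indicator {E. ?s E} E"
      by simp
  qed
  also have "\<dots> \<le> exp (- (real m ^ 2 / d * ?g)) *
      exp (- (real m ^ 2 / d * (real (card X) * real (card Y))))"
  proof (intro mult_left_mono)
    have "real (2 * size E0 + 2 * m * n + m) \<le> d"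
      using step.prems by (rule order_trans[rotated]) simp
    then show "measure_pmf.prob (BA_graph m n0 E0 n) {E. ?s E}
      \<le> exp (- (real m ^ 2 / d * (real (card X) * real (card Y))))"
      using step.IH unfolding X_def Y_def by blast
  qed simp
  also have "\<dots> = exp (- (real m ^ 2 / d * (?g + real (card X) * real (card Y))))"
    by (simp add: exp_add[symmetric] distrib_left)
  \<comment> \<open>Since \<open>A\<close> and \<open>B\<close> are disjoint, \<open>Suc n\<close>
    enlarges at most one factor and no extra summand 1 arises.\<close>
  also have "?g + real (card X) * real (card Y) =
    real (card (A \<inter> {n0<..Suc n})) * real (card (B \<inter> {n0<..Suc n}))"
  proof -
    have "Z \<inter> {n0<..Suc n} = (if Suc n \<in> Z then insert (Suc n) (Z \<inter> {n0<..n}) else Z \<inter> {n0<..n})" for Z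
      using step.hyps(1) by (auto simp: le_Suc_eq)
    then have "card (A \<inter> {n0<..Suc n}) = (if Suc n \<in> A then 1 else 0) + card X"
      "card (B \<inter> {n0<..Suc n}) = (if Suc n \<in> B then 1 else 0) + card Y"
      unfolding X_def Y_def by simp_all
    then show ?thesis using disj by (auto simp: algebra_simps)
  qed
  finally show ?case .
qed

section \<open>The union bound\<close>

text \<open>A disjoint pair labels each element of \<open>S\<close> by 0, 1 or 2: in
  \<open>A\<close>, in \<open>B\<close>, or in neither.\<close>

lemma card_disjoint_pairs_le:
  assumes "finite S"
  shows "card {(A, B). A \<subseteq> S \<and> B \<subseteq> S \<and> A \<inter> B = {}} \<le> 3 ^ card S"
    and "finite {(A, B). A \<subseteq> S \<and> B \<subseteq> S \<and> A \<inter> B = {}}"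
proof -
  let ?T = "{(A, B). A \<subseteq> S \<and> B \<subseteq> S \<and> A \<inter> B = {}}"
  let ?h = "\<lambda>f. ({x\<in>S. f x = 0}, {x\<in>S. f x = (1::nat)})"
  let ?F = "PiE S (\<lambda>_. {0, 1, 2::nat})"
  have sub: "?T \<subseteq> ?h ` ?F"
  proof clarify
    fix A B assume AB: "A \<subseteq> S" "B \<subseteq> S" "A \<inter> B = {}"
    let ?f = "\<lambda>x\<in>S. if x \<in> A then 0 else if x \<in> B then 1 else (2::nat)"
    have "(A, B) = ?h ?f" using AB by (auto split: if_splits)
    moreover have "?f \<in> ?F" by auto
    ultimately show "(A, B) \<in> ?h ` ?F" by (rule image_eqI)
  qed
  have finF: "finite ?F" using assms by (intro finite_PiE) auto
  have "card ?T \<le> card (?h ` ?F)" using sub finF by (intro card_mono) auto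
  also have "\<dots> \<le> card ?F" using finF by (rule card_image_le)
  also have "\<dots> = 3 ^ card S" using assms by (simp add: card_PiE numeral_3_eq_3)
  finally show "card ?T \<le> 3 ^ card S" .
  show "finite ?T" by (rule finite_subset[OF sub finite_imageI[OF finF]])
qed

text \<open>Union bound over the separated pairs with large product. The subtracted term accounts
  for the initial vertices, which the bound for a fixed pair does not count.\<close>

lemma prob_small_treewidth_le:
  fixes m :: nat
  assumes init: "initial_graph n0 E0" and n: "n0 \<le> n" "100 \<le> n"
  defines "d \<equiv> real (2 * size E0 + 2 * m * n + m)"
  shows "measure_pmf.prob (BA_graph m n0 E0 n)
      {E. real (treewidth {1..n} (set_mset E)) \<le> real n / 100}
    \<le> 3 ^ n * exp (- (real m ^ 2 / d * (real n ^ 2 / 5 - 2 * real n0 * real n)))"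
proof -
  let ?p = "BA_graph m n0 E0 n"
  let ?L = "{E. real (treewidth {1..n} (set_mset E)) \<le> real n / 100}"
  let ?T = "{(A, B). A \<subseteq> {1..n} \<and> B \<subseteq> {1..n} \<and> A \<inter> B = {}}"
  let ?R = "{(A, B) \<in> ?T. real n ^ 2 / 5 \<le> real (card A) * real (card B)}"
  let ?ev = "\<lambda>(A, B). {E. no_edges_between (set_mset E) A B}"
  let ?c = "exp (- (real m ^ 2 / d * (real n ^ 2 / 5 - 2 * real n0 * real n)))"
  have finR: "finite ?R" using card_disjoint_pairs_le(2)[of "{1..n}"] by (rule rev_finite_subset) auto
  \<comment> \<open>The restriction to the support guarantees a multigraph on \<open>{1..n}\<close>,
    as the separation requires.\<close>
  have "?L \<inter> set_pmf ?p \<subseteq> (\<Union>r\<in>?R. ?ev r)"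
  proof
    fix E assume "E \<in> ?L \<inter> set_pmf ?p"
    moreover from this have "multigraph_on n E" using set_BA_graph[OF init n(1)] by blast
    ultimately obtain A B where "A \<subseteq> {1..n}" "B \<subseteq> {1..n}" "A \<inter> B = {}"
      "no_edges_between (set_mset E) A B" "real n ^ 2 / 5 \<le> real (card A) * real (card B)"
      using small_treewidth_imp_separated_pair[of n E] n(2) by blast
    then show "E \<in> (\<Union>r\<in>?R. ?ev r)" by (intro UN_I[of "(A, B)"]) auto
  qed
  then have "measure_pmf.prob ?p ?L \<le> measure_pmf.prob ?p (\<Union>r\<in>?R. ?ev r)"
    by (subst measure_Int_set_pmf[symmetric]) (intro measure_pmf.finite_measure_mono, auto)
  also have "\<dots> \<le> (\<Sum>r\<in>?R. measure_pmf.prob ?p (?ev r))"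
    using finR by (intro measure_pmf.finite_measure_subadditive_finite) auto
  also have "\<dots> \<le> (\<Sum>r\<in>?R. ?c)"
  proof (rule sum_mono)
    fix r assume "r \<in> ?R"
    then obtain A B where r: "r = (A, B)" and AB: "A \<subseteq> {1..n}" "B \<subseteq> {1..n}" "A \<inter> B = {}"
      "real n ^ 2 / 5 \<le> real (card A) * real (card B)" by blast
    let ?A = "A \<inter> {n0<..n}" and ?B = "B \<inter> {n0<..n}"
    have le: "card Z \<le> card (Z \<inter> {n0<..n}) + n0" "card (Z \<inter> {n0<..n}) \<le> n" "card Z \<le> n"
      if Z: "Z \<subseteq> {1..n}" for Z
    proof -
      have "card Z \<le> card ((Z \<inter> {n0<..n}) \<union> {1..n0})"
        using Z by (intro card_mono) auto
      also have "\<dots> \<le> card (Z \<inter> {n0<..n}) + card {1..n0}" by (rule card_Un_le)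
      finally show "card Z \<le> card (Z \<inter> {n0<..n}) + n0" by simp
      show "card Z \<le> n" using card_mono[OF _ Z] by simp
      have "Z \<inter> {n0<..n} \<subseteq> {1..n}" using Z by blast
      then show "card (Z \<inter> {n0<..n}) \<le> n" using card_mono[of "{1..n}" "Z \<inter> {n0<..n}"] by simp
    qed
    \<comment> \<open>Discarding the initial vertices from \<open>B\<close> and then from
      \<open>A\<close> costs at most \<open>n * n0\<close> each time.\<close>
    have "card A * card B \<le> card A * (card ?B + n0)" using le(1)[OF AB(2)] by simp
    also have "\<dots> = card A * card ?B + card A * n0" by (simp add: algebra_simps)
    also have "\<dots> \<le> (card ?A + n0) * card ?B + n * n0"
      using le(1,3)[OF AB(1)] by (intro add_mono mult_right_mono) auto
    also have "\<dots> \<le> card ?A * card ?B + 2 * n0 * n"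
      using le(2)[OF AB(2)] by (simp add: algebra_simps)
    finally have "real (card A * card B) \<le> real (card ?A * card ?B + 2 * n0 * n)"
      by (rule of_nat_mono)
    then have "real n ^ 2 / 5 - 2 * real n0 * real n \<le> real (card ?A) * real (card ?B)"
      using AB(4) by simp
    then have "real m ^ 2 / d * (real n ^ 2 / 5 - 2 * real n0 * real n)
        \<le> real m ^ 2 / d * (real (card ?A) * real (card ?B))"
      by (intro mult_left_mono) (auto simp: d_def)
    then have "exp (- (real m ^ 2 / d * (real (card ?A) * real (card ?B)))) \<le> ?c" by simp
    moreover have "real (2 * size E0 + 2 * m * n + m) \<le> d" unfolding d_def by (rule order_refl)
    ultimately show "measure_pmf.prob ?p (?ev r) \<le> ?c"
      using prob_BA_graph_no_edges_between[OF init AB(3) n(1), of m d] unfolding r prod.case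
      by linarith
  qed
  also have "\<dots> = real (card ?R) * ?c" by simp
  also have "\<dots> \<le> 3 ^ n * ?c"
  proof (intro mult_right_mono)
    have "card ?R \<le> card ?T" using card_disjoint_pairs_le(2)[of "{1..n}"] by (intro card_mono) auto
    then have "card ?R \<le> 3 ^ n" using card_disjoint_pairs_le(1)[of "{1..n}"] by simp
    then have "real (card ?R) \<le> real (3 ^ n)" by (rule of_nat_mono)
    then show "real (card ?R) \<le> 3 ^ n" by simp
  qed simp
  finally show ?thesis .
qed

section \<open>Passage to the limit\<close>

theorem theorem3:
  fixes m :: nat
  assumes "m \<ge> 12"
  shows "\<exists>\<beta>::real. \<beta> > 0 \<and>
    (\<forall>n0 E0. initial_graph n0 E0 \<longrightarrow>
      (\<lambda>n. measure_pmf.prob (BA_graph m n0 E0 n)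
             {E. real (treewidth {1..n} (set_mset E)) > \<beta> * real n})
        \<longlonglongrightarrow> 1)"
proof (intro exI[of _ "1/100"] conjI allI impI)
  fix n0 E0 assume init: "initial_graph n0 E0"
  let ?P = "\<lambda>n. measure_pmf.prob (BA_graph m n0 E0 n)"
  let ?L = "\<lambda>n. {E. real (treewidth {1..n} (set_mset E)) \<le> real n / 100}"
  let ?d = "\<lambda>n. real (2 * size E0 + 2 * m * n + m)"
  \<comment> \<open>115/100 lies between ln 3 and 12/10, the rate for \<open>m = 12\<close>, which
    leaves room for lower-order terms. It equals 23 * 5/100, hence the exponent 23 below.\<close>
  let ?r = "3 / exp (115/100 :: real)"
  have "(3::real) < (1 + 5/100) ^ 23" by (simp add: power_divide)
  also have "\<dots> \<le> exp (5/100) ^ 23" by (intro power_mono exp_ge_add_one_self) auto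
  also have "\<dots> = exp (115/100)" by (simp flip: exp_of_nat_mult)
  finally have r: "?r < 1" by simp
  \<comment> \<open>The terms that stay constant once a factor \<open>n\<close> is cancelled: the
    excess of \<open>?d n\<close> over \<open>2 * m * n\<close>, and the loss from the initial
    vertices.\<close>
  define c where "c = 23/20 * (2 * real (size E0) + real m) + 2 * real n0 * real m ^ 2"
  have bound: "?P n (?L n) \<le> ?r ^ n" if n: "n0 \<le> n" "100 \<le> n" "c \<le> real n" for n
  proof -
    have d: "?d n > 0" using assms by (subst of_nat_0_less_iff) simp
    \<comment> \<open>This is where \<open>m \<ge> 12\<close> enters: the bracket is at least 1/10,
      whereas it is negative for \<open>m = 11\<close>.\<close>
    have "1 * real n \<le> real m * (real m / 5 - 23/10) * real n"
    proof (intro mult_right_mono)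
      have "12 * (1/10) \<le> real m * (real m / 5 - 23/10)" using assms by (intro mult_mono) auto
      then show "1 \<le> real m * (real m / 5 - 23/10)" by simp
    qed simp
    then have "c \<le> real m * (real m / 5 - 23/10) * real n" using n(3) by simp
    then have "115/100 * ?d n \<le> real m ^ 2 * (real n / 5 - 2 * real n0)"
      unfolding c_def by (simp add: algebra_simps add_divide_distrib power2_eq_square)
    then have "115/100 * ?d n * real n \<le> real m ^ 2 * (real n / 5 - 2 * real n0) * real n"
      by (rule mult_right_mono) simp
    then have "115/100 * real n \<le> real m ^ 2 / ?d n * (real n ^ 2 / 5 - 2 * real n0 * real n)"
      using d by (simp add: field_simps power2_eq_square)
    then have "exp (- (real m ^ 2 / ?d n * (real n ^ 2 / 5 - 2 * real n0 * real n)))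
      \<le> exp (- (115/100 * real n))" by simp
    then have "?P n (?L n) \<le> 3 ^ n * exp (- (115/100 * real n))"
      using prob_small_treewidth_le[OF init n(1,2), of m]
      by (elim order_trans) (intro mult_left_mono, auto)
    also have "exp (- (115/100 * real n)) = inverse (exp (115/100) ^ n)"
      by (simp only: exp_minus mult.commute[of "115/100"] exp_of_nat_mult)
    also have "3 ^ n * inverse (exp (115/100) ^ n) = ?r ^ n"
      unfolding power_divide by (rule divide_inverse[symmetric])
    finally show ?thesis .
  qed
  have "(\<lambda>n. ?P n (?L n)) \<longlonglongrightarrow> 0"
  proof (rule tendsto_sandwich[of "\<lambda>_. 0"])
    show "\<forall>\<^sub>F n in sequentially. ?P n (?L n) \<le> ?r ^ n"
      using eventually_ge_at_top[of "max (max n0 100) (nat \<lceil>c\<rceil>)"]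
    proof eventually_elim
      case (elim n)
      have "c \<le> real n" using elim by linarith
      then show ?case using elim bound by simp
    qed
    show "(\<lambda>n. ?r ^ n) \<longlonglongrightarrow> 0" using r by (intro LIMSEQ_realpow_zero) auto
  qed auto
  then have "(\<lambda>n. 1 - ?P n (?L n)) \<longlonglongrightarrow> 1 - 0" by (intro tendsto_intros)
  moreover have "1 - ?P n (?L n) = ?P n {E. real (treewidth {1..n} (set_mset E)) > 1/100 * real n}" for n
  proof -
    have "- ?L n = {E. real (treewidth {1..n} (set_mset E)) > 1/100 * real n}" by auto
    then show ?thesis
      using measure_pmf.prob_compl[of "?L n" "BA_graph m n0 E0 n"] by (simp add: Compl_eq_Diff_UNIV)
  qed
  ultimately show "(\<lambda>n. ?P n {E. real (treewidth {1..n} (set_mset E)) > 1/100 * real n}) \<longlonglongrightarrow> 1"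
    by simp
qed simp

end
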